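(* Consider a platoon of $N$ followers with lossy channels whose stacked state $\mathbf{x}$, tracking error $\bm{\zeta}$ and channel input $\mathbf{v}$ satisfy, for all $k\ge0$, $$\mathbf{x}(k+1)=\mathbf{A}\mathbf{x}(k)+\mathbf{B}y_0(k)+\mathcal{B}\breve{\mathbf{v}}(k),\quad \bm{\zeta}(k)=\mathbf{C}_{\bm{\zeta}}\mathbf{x}(k)+\mathbf{D}_{\bm{\zeta}}y_0(k),\quad \mathbf{v}(k)=\mathbf{C_v}\mathbf{x}(k)+\mathbf{D_v}y_0(k),$$ with $\breve{\mathbf{v}}(k)=\bar\Theta_d(k)\mathbf{v}(k)$ and matrices as in the context. Then the means of the state, tracking error and channel input satisfy $$\mu_{\mathbf{x}}(k+1)=\mathbf{A}\mu_{\mathbf{x}}(k)+\mathbf{B}y_0(k),\quad \mu_{\bm{\zeta}}(k)=\mathbf{C}_{\bm{\zeta}}\mu_{\mathbf{x}}(k)+\mathbf{D}_{\bm{\zeta}}y_0(k),\quad \mu_{\mathbf{v}}(k)=\mathbf{C_v}\mu_{\mathbf{x}}(k)+\mathbf{D_v}y_0(k),$$ and the corresponding covariance matrices satisfy $$P_{\mathbf{x}}(k+1)=\mathbf{A}P_{\mathbf{x}}(k)\mathbf{A}^\top+\mathcal{B}\left[P_\Theta\odot P_{\mathbf{v}}(k)\right]\mathcal{B}^\top+\mathcal{B}\left[P_\Theta\odot(\mu_{\mathbf{v}}(k)\mu_{\mathbf{v}}(k)^\top)\right]\mathcal{B}^\top,$$ $$P_{\bm{\zeta}}(k)=\mathbf{C}_{\bm{\zeta}}P_{\mathbf{x}}(k)\mathbf{C}_{\bm{\zeta}}^\top,\qquad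 P_{\mathbf{v}}(k)=\mathbf{C_v}P_{\mathbf{x}}(k)\mathbf{C_v}^\top.$$
   Context: Notation. $\odot$ is the Hadamard (entrywise) product. For a random vector $x(k)$: $\mu_x(k)=\mathcal{E}\{x(k)\}$, $P_x(k)=\mathcal{E}\{(x(k)-\mu_x(k))(x(k)-\mu_x(k))^\top\}$. Platoon. The leader (vehicle $0$) has deterministic position $y_0(k)\in\mathbb{R}$. Follower $i=1,\dots,N$ has position $y_i(k)$, tracking error $\zeta_i(k)$, channel input $v_i(k)\in\mathbb{R}^{n_v}$ and minimal state-space description $$x_i(k+1)=A_ix_i(k)+B_i\tilde v_i(k),\quad x_i(0)=x_{i0},$$ $$y_i(k)=C_{y_i}x_i(k),\quad \zeta_i(k)=C_{\zeta_i}x_i(k)+D_{\zeta_i}y_{i-1}(k),\quad v_i(k)=C_{v_i}x_i(k)+D_{v_i}y_{i-1}(k),$$ closed through the lossy channel $\tilde v_i(k)=\theta_i(k)v_i(k)$, where $x_{i0}$ is a given initial state and all matrices are real and constant. Stack $\mathbf{x}=[x_1^\top\cdots x_N^\top]^\top$, $\bm{\zeta}=[\zeta_1\cdots\zeta_N]^\top$, $\mathbf{v}=[v_1^\top\cdots v_N^\top]^\top$. Channels. $\theta_i(k)\in\{0,1\}$ is Bernoulli with $\mathcal{E}\{\theta_i(k)\}=p_i$. The vectors $\Theta(k)=[\theta_1(k),\dots,\theta_N(k)]^\top$ are i.i.d. in time, but at a given time their entries may be correlated; $P_\Theta$ is the covariance matrix of $\Theta(k)$. $\Theta_d(k)=\mathrm{diag}(\theta_1(k),\dots,\theta_N(k))$,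 $\Upsilon=\mathrm{diag}(p_1,\dots,p_N)$, $\bar\Theta_d(k)=\Theta_d(k)-\Upsilon$. Convention: if $n_v>1$, each $\theta_i$ (resp. $p_i$) is repeated $n_v$ times in $\Theta,\Theta_d$ (resp. $\Upsilon$) and $P_\Theta$ is the covariance of the repeated vector. Matrices. With $\alpha_i=A_i+p_iB_iC_{v_i}$ and $\gamma_i=p_iB_iD_{v_i}C_{y_{i-1}}$: - $\mathbf{A}$: block lower bidiagonal, diagonal blocks $\alpha_1,\dots,\alpha_N$, subdiagonal blocks $\gamma_2,\dots,\gamma_N$ ($\gamma_i$ in block row $i$, block column $i-1$); - $\mathbf{B}=[(p_1B_1D_{v_1})^\top\ 0\ \cdots\ 0]^\top$; $\mathcal{B}=\mathrm{diag}(B_1,\dots,B_N)$ (block diagonal); - $\mathbf{C}_{\bm{\zeta}}$: block lower bidiagonal, diagonal blocks $C_{\zeta_i}$, subdiagonal blocks $D_{\zeta_i}C_{y_{i-1}}$ ($i=2,\dots,N$); $\mathbf{D}_{\bm{\zeta}}=[D_{\zeta_1}^\top\ 0\ \cdots\ 0]^\top$; - $\mathbf{C_v}$: block lower bidiagonal, diagonal blocks $C_{v_i}$, subdiagonal blocks $D_{v_i}C_{y_{i-1}}$; $\mathbf{D_v}=[D_{v_1}^\top\ 0\ \cdots\ 0]^\top$. *)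

theory Defs
  imports "HOL-Probability.Probability" "Jordan_Normal_Form.Matrix"
begin

no_notation vec_nth (infixl \<open>$\<close> 90)
no_notation inner (infix \<open>\<bullet>\<close> 70)
hide_const (open) Finite_Cartesian_Product.vec Finite_Cartesian_Product.mat

section \<open>Stacked vectors and block matrices\<close>

text \<open>
  Blocks are numbered from 1, with block \<open>i\<close> of size \<open>d i\<close>, whereas vector and matrix entries
  are numbered from 0.  The flat position \<open>a\<close> is entry \<open>pos_in_block d a\<close> of block \<open>block_of d a\<close>.
\<close>

definition block_of :: "(nat \<Rightarrow> nat) \<Rightarrow> nat \<Rightarrow> nat" where
  "block_of d a = (LEAST i. a < (\<Sum>j=1..i. d j))"

definition pos_in_block :: "(nat \<Rightarrow> nat) \<Rightarrow> nat \<Rightarrow> nat" where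
  "pos_in_block d a = a - (\<Sum>j=1..<block_of d a. d j)"

definition block_vec :: "nat \<Rightarrow> (nat \<Rightarrow> nat) \<Rightarrow> (nat \<Rightarrow> real vec) \<Rightarrow> real vec" where
  "block_vec N d u = vec (\<Sum>i=1..N. d i) (\<lambda>a. u (block_of d a) $ pos_in_block d a)"

definition block_mat ::
    "nat \<Rightarrow> (nat \<Rightarrow> nat) \<Rightarrow> nat \<Rightarrow> (nat \<Rightarrow> nat) \<Rightarrow> (nat \<Rightarrow> nat \<Rightarrow> real mat) \<Rightarrow> real mat" where
  "block_mat R r S c Q =
     mat (\<Sum>i=1..R. r i) (\<Sum>j=1..S. c j)
       (\<lambda>(a, b). Q (block_of r a) (block_of c b) $$ (pos_in_block r a, pos_in_block c b))"

definition block_bidiag ::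
    "nat \<Rightarrow> (nat \<Rightarrow> nat) \<Rightarrow> (nat \<Rightarrow> nat) \<Rightarrow> (nat \<Rightarrow> real mat) \<Rightarrow> (nat \<Rightarrow> real mat) \<Rightarrow> real mat" where
  "block_bidiag N r c D L =
     block_mat N r N c (\<lambda>i j. if j = i then D i else if i = j + 1 then L i else 0\<^sub>m (r i) (c j))"

definition block_diag ::
    "nat \<Rightarrow> (nat \<Rightarrow> nat) \<Rightarrow> (nat \<Rightarrow> nat) \<Rightarrow> (nat \<Rightarrow> real mat) \<Rightarrow> real mat" where
  "block_diag N r c D =
     block_mat N r N c (\<lambda>i j. if j = i then D i else 0\<^sub>m (r i) (c j))"

text \<open>The single block column with \<open>F\<close> on top and zeros below; \<open>F\<close> itself has one column.\<close>

definition first_block_col :: "nat \<Rightarrow> (nat \<Rightarrow> nat) \<Rightarrow> real mat \<Rightarrow> real mat" where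
  "first_block_col N r F =
     block_mat N r 1 (\<lambda>_. 1) (\<lambda>i j. if i = 1 then F else 0\<^sub>m (r i) 1)"

definition hadamard :: "real mat \<Rightarrow> real mat \<Rightarrow> real mat" (infixl \<open>\<odot>\<close> 70) where
  "P \<odot> Q = mat (dim_row P) (dim_col P) (\<lambda>(a, b). P $$ (a, b) * Q $$ (a, b))"

text \<open>\<open>outer u v\<close> is the product of the column vector \<open>u\<close> with the transpose of \<open>v\<close>.\<close>

definition outer :: "real vec \<Rightarrow> real vec \<Rightarrow> real mat" where
  "outer u v = mat (dim_vec u) (dim_vec v) (\<lambda>(a, b). u $ a * v $ b)"

section \<open>Means and covariances of random vectors\<close>

definition mean_vec :: "'w measure \<Rightarrow> nat \<Rightarrow> ('w \<Rightarrow> real vec) \<Rightarrow> real vec" where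
  "mean_vec M d X = vec d (\<lambda>a. LINT w|M. X w $ a)"

definition mean_mat :: "'w measure \<Rightarrow> nat \<Rightarrow> nat \<Rightarrow> ('w \<Rightarrow> real mat) \<Rightarrow> real mat" where
  "mean_mat M r c X = mat r c (\<lambda>(a, b). LINT w|M. X w $$ (a, b))"

definition cov_mat :: "'w measure \<Rightarrow> nat \<Rightarrow> ('w \<Rightarrow> real vec) \<Rightarrow> real mat" where
  "cov_mat M d X =
     mean_mat M d d (\<lambda>w. outer (X w - mean_vec M d X) (X w - mean_vec M d X))"

section \<open>The platoon\<close>

text \<open>
  Follower \<open>i \<in> {1..nfol}\<close> obeys

    \<open>x i (k+1) = A i x i k + B i (\<theta> i k) v i k\<close>, \<open>x i 0 = x0 i\<close>,
    \<open>y i k = Cy i x i k\<close>,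
    \<open>\<zeta> i k = C\<zeta> i x i k + D\<zeta> i y (i-1) k\<close>,
    \<open>v i k = Cv i x i k + Dv i y (i-1) k\<close>,

  where \<open>prb i\<close> is the mean of \<open>\<theta> i k\<close>.  The scalars \<open>y\<close> and \<open>\<zeta>\<close> make \<open>Cy\<close> and \<open>C\<zeta>\<close> row vectors
  and \<open>D\<zeta>\<close> a matrix of size one; \<open>Dv\<close> is a column.
\<close>

record platoon =
  nfol :: nat
  nv :: nat
  nx :: "nat \<Rightarrow> nat"
  Am :: "nat \<Rightarrow> real mat"
  Bm :: "nat \<Rightarrow> real mat"
  Cy :: "nat \<Rightarrow> real mat"
  C\<zeta> :: "nat \<Rightarrow> real mat"
  D\<zeta> :: "nat \<Rightarrow> real mat"
  Cv :: "nat \<Rightarrow> real mat"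
  Dv :: "nat \<Rightarrow> real mat"
  prb :: "nat \<Rightarrow> real"
  x0 :: "nat \<Rightarrow> real vec"

text \<open>
  Least state dimension among all realizations of the same transfer function, i.e. of the same
  Markov parameters.  The direct feedthrough plays no role and is left out.
\<close>

definition minimal_realization :: "real mat \<Rightarrow> real mat \<Rightarrow> real mat \<Rightarrow> bool" where
  "minimal_realization A B C \<longleftrightarrow>
     (\<forall>m A' B' C'.
        A' \<in> carrier_mat m m \<and> B' \<in> carrier_mat m (dim_col B) \<and> C' \<in> carrier_mat (dim_row C) m \<and>
        (\<forall>k. C' * (A' ^\<^sub>m k) * B' = C * (A ^\<^sub>m k) * B)
        \<longrightarrow> dim_row A \<le> m)"

text \<open>
  A follower's predecessor position \<open>y (i-1)\<close> enters its outputs only, so the input matrix that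
  counts for minimality is \<open>B i\<close>; the outputs are \<open>y i\<close>, \<open>\<zeta> i\<close> and \<open>v i\<close>.
\<close>

definition platoon_wf :: "platoon \<Rightarrow> bool" where
  "platoon_wf P \<longleftrightarrow> 1 \<le> nfol P \<and> 1 \<le> nv P \<and>
     (\<forall>i\<in>{1..nfol P}.
        Am P i \<in> carrier_mat (nx P i) (nx P i) \<and>
        Bm P i \<in> carrier_mat (nx P i) (nv P) \<and>
        Cy P i \<in> carrier_mat 1 (nx P i) \<and>
        C\<zeta> P i \<in> carrier_mat 1 (nx P i) \<and>
        D\<zeta> P i \<in> carrier_mat 1 1 \<and>
        Cv P i \<in> carrier_mat (nv P) (nx P i) \<and>
        Dv P i \<in> carrier_mat (nv P) 1 \<and>
        x0 P i \<in> carrier_vec (nx P i) \<and>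
        minimal_realization (Am P i) (Bm P i) (Cy P i @\<^sub>r (C\<zeta> P i @\<^sub>r Cv P i)))"

definition dimX :: "platoon \<Rightarrow> nat" where
  "dimX P = (\<Sum>i=1..nfol P. nx P i)"

definition dimV :: "platoon \<Rightarrow> nat" where
  "dimV P = nfol P * nv P"

definition blA :: "platoon \<Rightarrow> real mat" where
  "blA P = block_bidiag (nfol P) (nx P) (nx P)
     (\<lambda>i. Am P i + prb P i \<cdot>\<^sub>m (Bm P i * Cv P i))
     (\<lambda>i. prb P i \<cdot>\<^sub>m (Bm P i * Dv P i * Cy P (i - 1)))"

definition blB :: "platoon \<Rightarrow> real mat" where
  "blB P = first_block_col (nfol P) (nx P) (prb P 1 \<cdot>\<^sub>m (Bm P 1 * Dv P 1))"

definition calB :: "platoon \<Rightarrow> real mat" where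
  "calB P = block_diag (nfol P) (nx P) (\<lambda>_. nv P) (Bm P)"

definition blC\<zeta> :: "platoon \<Rightarrow> real mat" where
  "blC\<zeta> P = block_bidiag (nfol P) (\<lambda>_. 1) (nx P) (C\<zeta> P) (\<lambda>i. D\<zeta> P i * Cy P (i - 1))"

definition blD\<zeta> :: "platoon \<Rightarrow> real mat" where
  "blD\<zeta> P = first_block_col (nfol P) (\<lambda>_. 1) (D\<zeta> P 1)"

definition blCv :: "platoon \<Rightarrow> real mat" where
  "blCv P = block_bidiag (nfol P) (\<lambda>_. nv P) (nx P) (Cv P) (\<lambda>i. Dv P i * Cy P (i - 1))"

definition blDv :: "platoon \<Rightarrow> real mat" where
  "blDv P = first_block_col (nfol P) (\<lambda>_. nv P) (Dv P 1)"

definition stackX :: "platoon \<Rightarrow> (nat \<Rightarrow> nat \<Rightarrow> 'w \<Rightarrow> real vec) \<Rightarrow> nat \<Rightarrow> 'w \<Rightarrow> real vec" where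
  "stackX P x k w = block_vec (nfol P) (nx P) (\<lambda>i. x i k w)"

definition stack\<zeta> :: "platoon \<Rightarrow> (nat \<Rightarrow> nat \<Rightarrow> 'w \<Rightarrow> real) \<Rightarrow> nat \<Rightarrow> 'w \<Rightarrow> real vec" where
  "stack\<zeta> P \<zeta> k w = vec (nfol P) (\<lambda>a. \<zeta> (a + 1) k w)"

definition stackV :: "platoon \<Rightarrow> (nat \<Rightarrow> nat \<Rightarrow> 'w \<Rightarrow> real vec) \<Rightarrow> nat \<Rightarrow> 'w \<Rightarrow> real vec" where
  "stackV P v k w = block_vec (nfol P) (\<lambda>_. nv P) (\<lambda>i. v i k w)"

section \<open>The channels\<close>

text \<open>
  Independence and identical distribution concern the joint vectors \<open>(\<theta> 1 k, \<dots>, \<theta> N k)\<close> over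
  different times \<open>k\<close>; nothing is assumed about the dependence between the channels at one time.
\<close>

locale lossy_channels = prob_space M for M :: "'w measure" +
  fixes N :: nat and p :: "nat \<Rightarrow> real" and \<theta> :: "nat \<Rightarrow> nat \<Rightarrow> 'w \<Rightarrow> real"
  assumes binary: "i \<in> {1..N} \<Longrightarrow> w \<in> space M \<Longrightarrow> \<theta> i k w \<in> {0, 1}"
    and mean: "i \<in> {1..N} \<Longrightarrow> expectation (\<theta> i k) = p i"
    and indep: "indep_vars (\<lambda>_. Pi\<^sub>M {1..N} (\<lambda>_. borel)) (\<lambda>k w. \<lambda>i\<in>{1..N}. \<theta> i k w) UNIV"
    and ident: "distr M (Pi\<^sub>M {1..N} (\<lambda>_. borel)) (\<lambda>w. \<lambda>i\<in>{1..N}. \<theta> i k w) =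
                distr M (Pi\<^sub>M {1..N} (\<lambda>_. borel)) (\<lambda>w. \<lambda>i\<in>{1..N}. \<theta> i l w)"

text \<open>Each \<open>\<theta> i\<close> (and each \<open>prb i\<close>) is repeated \<open>nv\<close> times.\<close>

definition repeat_nv :: "platoon \<Rightarrow> (nat \<Rightarrow> real) \<Rightarrow> real vec" where
  "repeat_nv P s = block_vec (nfol P) (\<lambda>_. nv P) (\<lambda>i. vec (nv P) (\<lambda>_. s i))"

definition \<Theta>vec :: "platoon \<Rightarrow> (nat \<Rightarrow> nat \<Rightarrow> 'w \<Rightarrow> real) \<Rightarrow> nat \<Rightarrow> 'w \<Rightarrow> real vec" where
  "\<Theta>vec P \<theta> k w = repeat_nv P (\<lambda>i. \<theta> i k w)"

definition \<Theta>d :: "platoon \<Rightarrow> (nat \<Rightarrow> nat \<Rightarrow> 'w \<Rightarrow> real) \<Rightarrow> nat \<Rightarrow> 'w \<Rightarrow> real mat" where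
  "\<Theta>d P \<theta> k w = mat_diag (dimV P) (\<lambda>a. \<Theta>vec P \<theta> k w $ a)"

definition \<Upsilon> :: "platoon \<Rightarrow> real mat" where
  "\<Upsilon> P = mat_diag (dimV P) (\<lambda>a. repeat_nv P (prb P) $ a)"

definition \<Theta>d_bar :: "platoon \<Rightarrow> (nat \<Rightarrow> nat \<Rightarrow> 'w \<Rightarrow> real) \<Rightarrow> nat \<Rightarrow> 'w \<Rightarrow> real mat" where
  "\<Theta>d_bar P \<theta> k w = \<Theta>d P \<theta> k w - \<Upsilon> P"

text \<open>
  The vectors \<open>\<Theta>vec P \<theta> k\<close> are identically distributed in \<open>k\<close>, so their common covariance matrix
  is read off at time 0.
\<close>

definition P\<Theta> :: "'w measure \<Rightarrow> platoon \<Rightarrow> (nat \<Rightarrow> nat \<Rightarrow> 'w \<Rightarrow> real) \<Rightarrow> real mat" where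
  "P\<Theta> M P \<theta> = cov_mat M (dimV P) (\<Theta>vec P \<theta> 0)"

definition v_breve ::
    "platoon \<Rightarrow> (nat \<Rightarrow> nat \<Rightarrow> 'w \<Rightarrow> real) \<Rightarrow> (nat \<Rightarrow> nat \<Rightarrow> 'w \<Rightarrow> real vec) \<Rightarrow> nat \<Rightarrow> 'w \<Rightarrow> real vec" where
  "v_breve P \<theta> v k w = \<Theta>d_bar P \<theta> k w *\<^sub>v stackV P v k w"

text \<open>A scalar signal as a vector of length 1, to be multiplied by one-column matrices.\<close>

definition scal :: "real \<Rightarrow> real vec" where
  "scal r = vec 1 (\<lambda>_. r)"

end

theory Submission
  imports Defs
begin

text \<open>
  The state at time \<open>k\<close> is a bounded function of the channel outcomes at times before \<open>k\<close>, hence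
  independent of the outcomes at time \<open>k\<close>.  As the noise \<open>\<Theta>d_bar\<close> has mean zero, each entry of
  \<open>v_breve\<close> has mean zero and is uncorrelated with the state, so the update contributes no drift and
  no cross terms.  By the same independence, \<open>E (\<theta>\<^sub>a - p\<^sub>a) (\<theta>\<^sub>c - p\<^sub>c) v\<^sub>a v\<^sub>c\<close> is the product of the
  entry of \<open>P\<Theta>\<close> with \<open>E v\<^sub>a v\<^sub>c\<close>, and \<open>E v\<^sub>a v\<^sub>c\<close> is the covariance of \<open>v\<^sub>a\<close> and \<open>v\<^sub>c\<close> plus the
  product of their means.
\<close>

section \<open>Positions in stacked vectors\<close>

text \<open>By leastness the blocks before \<open>block_of d a\<close> have total length at most
  \<open>a\<close>, while adding that block exceeds \<open>a\<close>. Blocks of length zero are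
  therefore never selected.\<close>

lemma block_of_bounds:
  assumes "a < (\<Sum>i=1..N. d i)"
  shows "block_of d a \<in> {1..N}" and "pos_in_block d a < d (block_of d a)"
proof -
  let ?Q = "\<lambda>i. a < (\<Sum>j=1..i. d j)"
  have Q: "?Q (block_of d a)"
    unfolding block_of_def using assms by (rule LeastI)
  have le: "block_of d a \<le> N"
    unfolding block_of_def using assms by (rule Least_le)
  have pos: "block_of d a \<noteq> 0"
    using Q by (metis atLeastatMost_empty less_numeral_extra(1) not_less_zero sum.empty)
  then show "block_of d a \<in> {1..N}"
    using le by simp
  obtain i where i: "block_of d a = Suc i"
    using pos not0_implies_Suc by blast
  \<comment> \<open>The preceding blocks end at or before \<open>a\<close>, so the natural-number
    subtraction in \<open>pos_in_block\<close> does not truncate.\<close>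
  have "\<not> ?Q i"
    using i not_less_Least[of i ?Q] unfolding block_of_def by simp
  then show "pos_in_block d a < d (block_of d a)"
    using Q unfolding pos_in_block_def i by (simp add: atLeastLessThanSuc_atLeastAtMost)
qed

lemma repeat_nv_index:
  assumes "a < dimV P"
  shows "repeat_nv P s $ a = s (block_of (\<lambda>_. nv P) a)"
    and "block_of (\<lambda>_. nv P) a \<in> {1..nfol P}"
proof -
  have a: "a < (\<Sum>i=1..nfol P. nv P)"
    using assms by (simp add: dimV_def)
  show "repeat_nv P s $ a = s (block_of (\<lambda>_. nv P) a)"
    using a block_of_bounds(2)[OF a] by (simp add: repeat_nv_def block_vec_def)
  show "block_of (\<lambda>_. nv P) a \<in> {1..nfol P}"
    using block_of_bounds(1)[OF a] .
qed

section \<open>Entries of products\<close>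

lemma mult_mat_vec_entry:
  fixes A :: "real mat"
  assumes "A \<in> carrier_mat m n" "u \<in> carrier_vec n" "a < m"
  shows "(A *\<^sub>v u) $ a = (\<Sum>b<n. A $$ (a, b) * u $ b)"
  using assms by (auto simp: scalar_prod_def lessThan_atLeast0 intro!: sum.cong)

lemma mult_mat_entry:
  fixes A :: "real mat"
  assumes "A \<in> carrier_mat m n" "B \<in> carrier_mat n l" "a < m" "b < l"
  shows "(A * B) $$ (a, b) = (\<Sum>c<n. A $$ (a, c) * B $$ (c, b))"
  using assms by (auto simp: scalar_prod_def lessThan_atLeast0 intro!: sum.cong)

lemma congruence_entry:
  fixes A :: "real mat"
  assumes "A \<in> carrier_mat m n" "Q \<in> carrier_mat n n" "a < m" "b < m"
  shows "(A * Q * transpose_mat A) $$ (a, b)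
    = (\<Sum>c<n. \<Sum>d<n. A $$ (a, d) * Q $$ (d, c) * A $$ (b, c))"
proof -
  have "(A * Q * transpose_mat A) $$ (a, b) = (\<Sum>c<n. (A * Q) $$ (a, c) * A $$ (b, c))"
    using assms by (subst mult_mat_entry[where n = n and m = m and l = m]) auto
  also have "\<dots> = (\<Sum>c<n. \<Sum>d<n. A $$ (a, d) * Q $$ (d, c) * A $$ (b, c))"
    using assms
    by (intro sum.cong refl, subst mult_mat_entry[where n = n and m = m and l = n])
       (auto simp: sum_distrib_right)
  finally show ?thesis .
qed

section \<open>Bounded random vectors\<close>

text \<open>Boundedness survives sums and products and gives integrability on a finite measure, so
  integrability reduces to closure rules. The bound holds everywhere rather than almost everywhere
  because the notion is also used on a \<open>vimage_algebra\<close>, whose measure is zero.\<close>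

definition bounded_rv :: "'w measure \<Rightarrow> ('w \<Rightarrow> real) \<Rightarrow> bool" where
  "bounded_rv M f \<longleftrightarrow> f \<in> borel_measurable M \<and> (\<exists>c. \<forall>w\<in>space M. \<bar>f w\<bar> \<le> c)"

lemma bounded_rv_const [simp]: "bounded_rv M (\<lambda>_. c)"
  by (auto simp: bounded_rv_def)

lemma bounded_rv_cong:
  "(\<And>w. w \<in> space M \<Longrightarrow> f w = g w) \<Longrightarrow> bounded_rv M f \<longleftrightarrow> bounded_rv M g"
  unfolding bounded_rv_def by (metis (no_types, lifting) measurable_cong)

lemma bounded_rv_add:
  assumes "bounded_rv M f" "bounded_rv M g"
  shows "bounded_rv M (\<lambda>w. f w + g w)"
proof -
  obtain c e where "\<And>w. w \<in> space M \<Longrightarrow> \<bar>f w\<bar> \<le> c" "\<And>w. w \<in> space M \<Longrightarrow> \<bar>g w\<bar> \<le> e"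
    using assms unfolding bounded_rv_def by metis
  then have "\<forall>w\<in>space M. \<bar>f w + g w\<bar> \<le> c + e"
    by (meson abs_triangle_ineq add_mono order_trans)
  then show ?thesis
    using assms unfolding bounded_rv_def by auto
qed

lemma bounded_rv_mult:
  assumes "bounded_rv M f" "bounded_rv M g"
  shows "bounded_rv M (\<lambda>w. f w * g w)"
proof -
  obtain c e where "\<And>w. w \<in> space M \<Longrightarrow> \<bar>f w\<bar> \<le> c" "\<And>w. w \<in> space M \<Longrightarrow> \<bar>g w\<bar> \<le> e"
    using assms unfolding bounded_rv_def by metis
  then have "\<forall>w\<in>space M. \<bar>f w * g w\<bar> \<le> c * e"
    by (metis abs_ge_zero abs_mult mult_mono order_trans)
  then show ?thesis
    using assms unfolding bounded_rv_def by auto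
qed

lemma bounded_rv_diff:
  assumes "bounded_rv M f" "bounded_rv M g"
  shows "bounded_rv M (\<lambda>w. f w - g w)"
  using bounded_rv_add[OF assms(1) bounded_rv_mult[OF bounded_rv_const[of M "-1"] assms(2)]]
  by simp

lemma bounded_rv_sum:
  "(\<And>i. i \<in> I \<Longrightarrow> bounded_rv M (f i)) \<Longrightarrow> bounded_rv M (\<lambda>w. \<Sum>i\<in>I. f i w)"
  by (induction I rule: infinite_finite_induct) (auto intro: bounded_rv_add)

lemmas bounded_rv_intros =
  bounded_rv_const bounded_rv_add bounded_rv_mult bounded_rv_diff bounded_rv_sum

lemma bounded_rv_subalgebra:
  "subalgebra M F \<Longrightarrow> bounded_rv F f \<Longrightarrow> bounded_rv M f"
  unfolding bounded_rv_def using measurable_from_subalg by (auto simp: subalgebra_def)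

lemma (in finite_measure) integrable_bounded_rv: "bounded_rv M f \<Longrightarrow> integrable M f"
  unfolding bounded_rv_def by (metis AE_I2 integrable_const_bound real_norm_def)

definition bounded_rvec :: "'w measure \<Rightarrow> nat \<Rightarrow> ('w \<Rightarrow> real vec) \<Rightarrow> bool" where
  "bounded_rvec M n X \<longleftrightarrow>
     (\<forall>w\<in>space M. X w \<in> carrier_vec n) \<and> (\<forall>a<n. bounded_rv M (\<lambda>w. X w $ a))"

lemma bounded_rvec_carrier: "bounded_rvec M n X \<Longrightarrow> w \<in> space M \<Longrightarrow> X w \<in> carrier_vec n"
  by (simp add: bounded_rvec_def)

lemma bounded_rvec_entry: "bounded_rvec M n X \<Longrightarrow> a < n \<Longrightarrow> bounded_rv M (\<lambda>w. X w $ a)"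
  by (simp add: bounded_rvec_def)

lemma bounded_rvec_subalgebra:
  "subalgebra M F \<Longrightarrow> bounded_rvec F n X \<Longrightarrow> bounded_rvec M n X"
  unfolding bounded_rvec_def using bounded_rv_subalgebra[of M F] by (auto simp: subalgebra_def)

lemma bounded_rvec_cong:
  "(\<And>w. w \<in> space M \<Longrightarrow> X w = Y w) \<Longrightarrow> bounded_rvec M n X \<longleftrightarrow> bounded_rvec M n Y"
  unfolding bounded_rvec_def
  by (intro conj_cong ball_cong all_cong refl bounded_rv_cong) simp_all

lemma bounded_rvec_const: "u \<in> carrier_vec n \<Longrightarrow> bounded_rvec M n (\<lambda>_. u)"
  by (simp add: bounded_rvec_def)

lemma bounded_rvec_add:
  assumes "bounded_rvec M n X" "bounded_rvec M n Y"
  shows "bounded_rvec M n (\<lambda>w. X w + Y w)"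
  unfolding bounded_rvec_def
proof (intro conjI ballI allI impI)
  fix a assume a: "a < n"
  have "bounded_rv M (\<lambda>w. X w $ a + Y w $ a)"
    using assms a by (intro bounded_rv_add bounded_rvec_entry)
  moreover have "(X w + Y w) $ a = X w $ a + Y w $ a" if "w \<in> space M" for w
    using bounded_rvec_carrier[OF assms(2) that] a by auto
  ultimately show "bounded_rv M (\<lambda>w. (X w + Y w) $ a)"
    using bounded_rv_cong by (metis (no_types, lifting))
qed (use assms in \<open>auto simp: bounded_rvec_def\<close>)

lemma bounded_rvec_mult_mat:
  assumes A: "A \<in> carrier_mat m n" and X: "bounded_rvec M n X"
  shows "bounded_rvec M m (\<lambda>w. A *\<^sub>v X w)"
  unfolding bounded_rvec_def
proof (intro conjI ballI allI impI)
  fix a assume a: "a < m"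
  have "bounded_rv M (\<lambda>w. \<Sum>b<n. A $$ (a, b) * X w $ b)"
    using X by (intro bounded_rv_intros) (auto intro: bounded_rvec_entry)
  then show "bounded_rv M (\<lambda>w. (A *\<^sub>v X w) $ a)"
    using mult_mat_vec_entry[OF A bounded_rvec_carrier[OF X] a]
    by (subst bounded_rv_cong) auto
qed (auto intro: mult_mat_vec_carrier[OF A] bounded_rvec_carrier[OF X])

section \<open>Means and covariances of affine images and of sums\<close>

lemma mean_vec_cong:
  "(\<And>w. w \<in> space M \<Longrightarrow> X w = Y w) \<Longrightarrow> mean_vec M n X = mean_vec M n Y"
  unfolding mean_vec_def by (intro eq_vecI) (auto intro: Bochner_Integration.integral_cong)

lemma mean_vec_index: "a < n \<Longrightarrow> mean_vec M n X $ a = (LINT w|M. X w $ a)"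
  by (simp add: mean_vec_def)

lemma mean_vec_carrier [simp]: "mean_vec M n X \<in> carrier_vec n"
  by (simp add: mean_vec_def)

lemma cov_mat_carrier [simp]: "cov_mat M n X \<in> carrier_mat n n"
  by (simp add: cov_mat_def mean_mat_def)

lemma cov_mat_cong:
  assumes "\<And>w. w \<in> space M \<Longrightarrow> X w = Y w"
  shows "cov_mat M n X = cov_mat M n Y"
proof -
  have "mean_vec M n X = mean_vec M n Y"
    using assms by (rule mean_vec_cong)
  then show ?thesis
    unfolding cov_mat_def mean_mat_def
    by (intro eq_matI) (auto simp: assms intro!: Bochner_Integration.integral_cong)
qed

lemma cov_mat_index:
  assumes "\<And>w. w \<in> space M \<Longrightarrow> X w \<in> carrier_vec n" "a < n" "b < n"
  shows "cov_mat M n X $$ (a, b)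
    = (LINT w|M. (X w $ a - (LINT w|M. X w $ a)) * (X w $ b - (LINT w|M. X w $ b)))"
  using assms
  by (auto simp: cov_mat_def mean_mat_def outer_def mean_vec_def
      intro!: Bochner_Integration.integral_cong)

context prob_space
begin

lemma mean_vec_affine:
  assumes A: "A \<in> carrier_mat m n" and b: "b \<in> carrier_vec m" and X: "bounded_rvec M n X"
  shows "mean_vec M m (\<lambda>w. A *\<^sub>v X w + b) = A *\<^sub>v mean_vec M n X + b"
proof (intro eq_vecI)
  fix a assume "a < dim_vec (A *\<^sub>v mean_vec M n X + b)"
  then have a: "a < m"
    using b by auto
  have int: "integrable M (\<lambda>w. X w $ c)" if "c < n" for c
    using X that by (intro integrable_bounded_rv bounded_rvec_entry)
  have "mean_vec M m (\<lambda>w. A *\<^sub>v X w + b) $ a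
      = (LINT w|M. (\<Sum>c<n. A $$ (a, c) * X w $ c) + b $ a)"
    unfolding mean_vec_index[OF a]
    using a b mult_mat_vec_entry[OF A bounded_rvec_carrier[OF X] a]
    by (intro Bochner_Integration.integral_cong) auto
  also have "\<dots> = (\<Sum>c<n. A $$ (a, c) * (LINT w|M. X w $ c)) + b $ a"
    \<comment> \<open>Total mass one leaves the constant \<open>b $ a\<close> unchanged under the
      integral.\<close>
    using int by (subst Bochner_Integration.integral_add) (auto simp: prob_space)
  also have "\<dots> = (A *\<^sub>v mean_vec M n X + b) $ a"
    using a b mult_mat_vec_entry[OF A mean_vec_carrier a, of M X] by (auto simp: mean_vec_index)
  finally show "mean_vec M m (\<lambda>w. A *\<^sub>v X w + b) $ a = (A *\<^sub>v mean_vec M n X + b) $ a" .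
qed (use b in \<open>auto simp: mean_vec_def\<close>)

text \<open>Centring cancels \<open>b\<close>, so each centred entry of the image is the
  combination, with coefficients from a row of \<open>A\<close>, of the centred entries of
  \<open>X\<close>; bilinearity does the rest.\<close>

lemma cov_mat_affine:
  assumes A: "A \<in> carrier_mat m n" and b: "b \<in> carrier_vec m" and X: "bounded_rvec M n X"
  shows "cov_mat M m (\<lambda>w. A *\<^sub>v X w + b) = A * cov_mat M n X * transpose_mat A"
proof (intro eq_matI)
  fix a a' assume "a < dim_row (A * cov_mat M n X * transpose_mat A)"
    and "a' < dim_col (A * cov_mat M n X * transpose_mat A)"
  then have a: "a < m" "a' < m"
    using A by auto
  define Y where "Y c w = X w $ c - (LINT w|M. X w $ c)" for c w
  have Y: "bounded_rv M (Y c)" if "c < n" for c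
    unfolding Y_def[abs_def] using X that by (intro bounded_rv_intros bounded_rvec_entry)
  have centred: "(A *\<^sub>v X w + b) $ e - (LINT w|M. (A *\<^sub>v X w + b) $ e) = (\<Sum>c<n. A $$ (e, c) * Y c w)"
    if e: "e < m" and w: "w \<in> space M" for e w
  proof -
    have "(LINT w|M. (A *\<^sub>v X w + b) $ e) = (A *\<^sub>v mean_vec M n X + b) $ e"
      using mean_vec_affine[OF A b X] mean_vec_index[OF e, of M "\<lambda>w. A *\<^sub>v X w + b"] by simp
    then show ?thesis
      using e b A mult_mat_vec_entry[OF A bounded_rvec_carrier[OF X w] e]
        mult_mat_vec_entry[OF A mean_vec_carrier e, of M X]
      by (simp add: Y_def mean_vec_index sum_subtractf right_diff_distrib)
  qed
  have car: "A *\<^sub>v X w + b \<in> carrier_vec m" if "w \<in> space M" for w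
    using mult_mat_vec_carrier[OF A bounded_rvec_carrier[OF X that]] b by simp
  have "cov_mat M m (\<lambda>w. A *\<^sub>v X w + b) $$ (a, a')
      = (LINT w|M. (\<Sum>c<n. A $$ (a, c) * Y c w) * (\<Sum>c<n. A $$ (a', c) * Y c w))"
    by (subst cov_mat_index[OF car a], assumption, intro Bochner_Integration.integral_cong refl)
       (simp only: centred[OF a(1)] centred[OF a(2)])
  \<comment> \<open>Swapping the two sums puts them in the order of \<open>congruence_entry\<close>,
    where the column index of the second factor \<open>A\<close> is outermost.\<close>
  also have "\<dots> = (LINT w|M. (\<Sum>c<n. \<Sum>d<n. A $$ (a, d) * A $$ (a', c) * (Y d w * Y c w)))"
    by (intro Bochner_Integration.integral_cong refl, subst sum_product, subst sum.swap)
       (simp add: mult_ac)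
  also have "\<dots> = (\<Sum>c<n. \<Sum>d<n. A $$ (a, d) * A $$ (a', c) * (LINT w|M. Y d w * Y c w))"
  proof -
    have int: "integrable M (\<lambda>w. A $$ (a, d) * A $$ (a', c) * (Y d w * Y c w))"
      if "c < n" "d < n" for c d
      using Y that by (intro integrable_bounded_rv bounded_rv_intros)
    have "(LINT w|M. (\<Sum>c<n. \<Sum>d<n. A $$ (a, d) * A $$ (a', c) * (Y d w * Y c w)))
        = (\<Sum>c<n. (LINT w|M. (\<Sum>d<n. A $$ (a, d) * A $$ (a', c) * (Y d w * Y c w))))"
      by (intro Bochner_Integration.integral_sum Bochner_Integration.integrable_sum int) auto
    also have "\<dots> = (\<Sum>c<n. \<Sum>d<n. (LINT w|M. A $$ (a, d) * A $$ (a', c) * (Y d w * Y c w)))"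
      by (intro sum.cong refl Bochner_Integration.integral_sum int) auto
    finally show ?thesis
      by simp
  qed
  also have "\<dots> = (A * cov_mat M n X * transpose_mat A) $$ (a, a')"
    using a X
    by (subst congruence_entry[OF A])
       (auto simp: cov_mat_index bounded_rvec_carrier Y_def mult_ac intro!: sum.cong)
  finally show "cov_mat M m (\<lambda>w. A *\<^sub>v X w + b) $$ (a, a')
    = (A * cov_mat M n X * transpose_mat A) $$ (a, a')" .
qed (use A in \<open>auto simp: cov_mat_def mean_mat_def\<close>)

text \<open>Only vanishing mixed moments are required, not independence: in the noise step
  \<open>W\<close> depends on the same past as \<open>U\<close>.\<close>

lemma cov_mat_add_uncorrelated:
  assumes U: "bounded_rvec M n U" and W: "bounded_rvec M n W"
    and zero: "\<And>b. b < n \<Longrightarrow> (LINT w|M. W w $ b) = 0"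
    and uncorr: "\<And>a b. a < n \<Longrightarrow> b < n \<Longrightarrow> (LINT w|M. U w $ a * W w $ b) = 0"
  shows "cov_mat M n (\<lambda>w. U w + W w) = cov_mat M n U + cov_mat M n W"
proof (intro eq_matI)
  fix a b assume "a < dim_row (cov_mat M n U + cov_mat M n W)"
    and "b < dim_col (cov_mat M n U + cov_mat M n W)"
  then have ab: "a < n" "b < n"
    by (simp_all add: cov_mat_def mean_mat_def)
  define Y where "Y c w = U w $ c - (LINT w|M. U w $ c)" for c w
  have Y: "bounded_rv M (Y c)" if "c < n" for c
    unfolding Y_def[abs_def] using U that by (intro bounded_rv_intros bounded_rvec_entry)
  have int: "integrable M (\<lambda>w. U w $ c)" "integrable M (\<lambda>w. W w $ c)" if "c < n" for c
    using U W that by (auto intro: integrable_bounded_rv bounded_rvec_entry)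
  \<comment> \<open>Centring \<open>U\<close> changes the mixed moment only by a multiple of the
    mean of \<open>W\<close>, which is zero.\<close>
  have YW: "(LINT w|M. Y c w * W w $ d) = 0" if "c < n" "d < n" for c d
  proof -
    have "integrable M (\<lambda>w. U w $ c * W w $ d)"
      using U W that by (intro integrable_bounded_rv bounded_rv_intros bounded_rvec_entry)
    then show ?thesis
      using that int by (simp add: Y_def left_diff_distrib zero uncorr)
  qed
  have centred: "(U w + W w) $ c - (LINT w|M. (U w + W w) $ c) = Y c w + W w $ c"
    if c: "c < n" and w: "w \<in> space M" for c w
  proof -
    have ent: "(U w + W w) $ c = U w $ c + W w $ c" if "w \<in> space M" for w
      using bounded_rvec_carrier[OF W that] c by auto
    have "(LINT w|M. (U w + W w) $ c) = (LINT w|M. U w $ c + W w $ c)"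
      by (intro Bochner_Integration.integral_cong refl ent)
    then show ?thesis
      using int c w by (simp add: ent Y_def zero)
  qed
  have "cov_mat M n (\<lambda>w. U w + W w) $$ (a, b)
      = (LINT w|M. (Y a w + W w $ a) * (Y b w + W w $ b))"
    using ab bounded_rvec_carrier[OF bounded_rvec_add[OF U W]]
    by (subst cov_mat_index) (auto simp: centred intro!: Bochner_Integration.integral_cong)
  also have "\<dots> = (LINT w|M. Y a w * Y b w + W w $ a * W w $ b + Y a w * W w $ b + Y b w * W w $ a)"
    by (simp add: algebra_simps)
  also have "\<dots> = (LINT w|M. Y a w * Y b w) + (LINT w|M. W w $ a * W w $ b)"
    using ab Y W
    by (simp add: YW integrable_bounded_rv bounded_rv_intros bounded_rvec_entry)
  also have "\<dots> = (cov_mat M n U + cov_mat M n W) $$ (a, b)"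
    using ab U W
    by (simp add: cov_mat_index bounded_rvec_carrier zero Y_def carrier_matD[OF cov_mat_carrier])
  finally show "cov_mat M n (\<lambda>w. U w + W w) $$ (a, b) = (cov_mat M n U + cov_mat M n W) $$ (a, b)" .
qed (simp_all add: cov_mat_def mean_mat_def)

section \<open>Multiplicative noise independent of the signal\<close>

text \<open>A function measurable for a pulled-back algebra generates a smaller one, and
  independence passes to smaller families of events. Thus no explicit representation of
  \<open>f\<close> as a function of \<open>H\<close> is needed.\<close>

lemma indep_var_vimage_algebra:
  fixes S T :: "'s measure" and f g :: "'a \<Rightarrow> real"
  assumes ind: "indep_var S H T K"
    and f: "f \<in> borel_measurable (vimage_algebra (space M) H S)"
    and g: "g \<in> borel_measurable (vimage_algebra (space M) K T)"
  shows "indep_var borel f borel g"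
proof -
  have sub: "subalgebra M (vimage_algebra (space M) J R)" if "J \<in> measurable M R" for J and R :: "'s measure"
    using that by (simp add: subalgebra_def sets_image_in_sets)
  have gen: "sigma_sets (space M) {h -` A \<inter> space M |A. A \<in> sets borel}
      \<subseteq> sigma_sets (space M) {J -` A \<inter> space M |A. A \<in> sets R}"
    if "h \<in> borel_measurable (vimage_algebra (space M) J R)"
    for h :: "'a \<Rightarrow> real" and J and R :: "'s measure"
    using measurable_sets[OF that]
    by (intro sigma_sets_mono) (auto simp: sets_vimage_algebra)
  have HK: "random_variable S H" "random_variable T K"
    using ind unfolding indep_var_eq by simp_all
  have "random_variable borel f" "random_variable borel g"
    using measurable_from_subalg[OF sub[OF HK(1)] f] measurable_from_subalg[OF sub[OF HK(2)] g] .
  then show ?thesis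
    using ind gen[OF f] gen[OF g] unfolding indep_var_eq indep_set_def
    by (auto elim!: indep_sets_mono_sets split: bool.splits)
qed

section \<open>Random variables determined by the past or by the present\<close>

context
  fixes S :: "'s measure" and T :: "'s measure" and H K
  assumes HK: "indep_var S H T K"
begin

abbreviation "past \<equiv> vimage_algebra (space M) H S"
abbreviation "present \<equiv> vimage_algebra (space M) K T"

lemma subalgebra_past: "subalgebra M past" and subalgebra_present: "subalgebra M present"
  using HK by (auto simp: subalgebra_def sets_image_in_sets indep_var_eq)

text \<open>All later factorizations of expectations in this context rest on this product
  rule.\<close>

lemma expectation_mult_past_present:
  assumes f: "bounded_rv past f" and g: "bounded_rv present g"
  shows "(LINT w|M. f w * g w) = (LINT w|M. f w) * (LINT w|M. g w)"
proof (rule indep_var_lebesgue_integral)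
  show "indep_var borel f borel g"
    using f g indep_var_vimage_algebra[OF HK] unfolding bounded_rv_def by blast
  show "integrable M f" "integrable M g"
    using bounded_rv_subalgebra[OF subalgebra_past f] bounded_rv_subalgebra[OF subalgebra_present g]
    by (auto intro: integrable_bounded_rv)
qed

section \<open>One step of a linear recursion with multiplicative noise\<close>

context
  fixes n m l :: nat and A B :: "real mat" and b :: "real vec" and X V Th Z :: "'a \<Rightarrow> real vec"
  assumes A: "A \<in> carrier_mat n l" and B: "B \<in> carrier_mat n m" and b: "b \<in> carrier_vec n"
    and X: "bounded_rvec past l X" and V: "bounded_rvec past m V" and Th: "bounded_rvec present m Th"
    and Z: "\<And>w. w \<in> space M \<Longrightarrow> Z w \<in> carrier_vec m"
    and Z_entry: "\<And>w a. w \<in> space M \<Longrightarrow> a < m \<Longrightarrow>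
      Z w $ a = (Th w $ a - (LINT w|M. Th w $ a)) * V w $ a"
begin

lemma
  assumes a: "a < m"
  shows noise_entry: "bounded_rv present (\<lambda>w. Th w $ a - (LINT w|M. Th w $ a))"
    and noise_mean: "(LINT w|M. Th w $ a - (LINT w|M. Th w $ a)) = 0"
proof -
  have *: "bounded_rv present (\<lambda>w. Th w $ a)"
    using Th a by (rule bounded_rvec_entry)
  then show "bounded_rv present (\<lambda>w. Th w $ a - (LINT w|M. Th w $ a))"
    by (intro bounded_rv_intros)
  show "(LINT w|M. Th w $ a - (LINT w|M. Th w $ a)) = 0"
    using integrable_bounded_rv[OF bounded_rv_subalgebra[OF subalgebra_present *]]
    by (simp add: prob_space)
qed

lemma bounded_Z: "bounded_rvec M m Z"
proof -
  have "bounded_rv M (\<lambda>w. Z w $ a)" if a: "a < m" for a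
  proof -
    have "bounded_rv M (\<lambda>w. (Th w $ a - (LINT w|M. Th w $ a)) * V w $ a)"
      using bounded_rv_subalgebra[OF subalgebra_present noise_entry[OF a]]
        bounded_rv_subalgebra[OF subalgebra_past bounded_rvec_entry[OF V a]]
      by (rule bounded_rv_mult)
    then show ?thesis
      using Z_entry a by (subst bounded_rv_cong) auto
  qed
  then show ?thesis
    using Z by (simp add: bounded_rvec_def)
qed

text \<open>The product of \<open>f\<close> with the entry of \<open>V\<close> is still determined
  by the past, so it separates from the centred noise, whose mean is zero. Leaving \<open>f\<close>
  arbitrary covers two needs: \<open>f = 1\<close> gives mean zero, and an entry of the state gives
  the absence of correlation.\<close>

lemma expectation_past_mult_Z:
  assumes f: "bounded_rv past f" and a: "a < m"
  shows "(LINT w|M. f w * Z w $ a) = 0"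
proof -
  have "(LINT w|M. f w * Z w $ a) = (LINT w|M. (f w * V w $ a) * (Th w $ a - (LINT w|M. Th w $ a)))"
    using a by (intro Bochner_Integration.integral_cong) (auto simp: Z_entry)
  also have "\<dots> = 0"
    using f a V noise_mean[OF a]
    by (subst expectation_mult_past_present)
       (auto intro: bounded_rv_mult bounded_rvec_entry noise_entry)
  finally show ?thesis .
qed

lemma expectation_past_mult_BZ:
  assumes f: "bounded_rv past f" and a: "a < n"
  shows "(LINT w|M. f w * (B *\<^sub>v Z w) $ a) = 0"
proof -
  have f': "bounded_rv M f"
    using f by (rule bounded_rv_subalgebra[OF subalgebra_past])
  have "(LINT w|M. f w * (B *\<^sub>v Z w) $ a) = (LINT w|M. (\<Sum>c<m. B $$ (a, c) * (f w * Z w $ c)))"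
    using mult_mat_vec_entry[OF B Z a]
    by (intro Bochner_Integration.integral_cong) (auto simp: sum_distrib_left mult_ac)
  also have "\<dots> = (\<Sum>c<m. (LINT w|M. B $$ (a, c) * (f w * Z w $ c)))"
    using f' bounded_Z
    by (intro Bochner_Integration.integral_sum integrable_bounded_rv bounded_rv_intros)
       (auto intro: bounded_rvec_entry)
  also have "\<dots> = 0"
    using f by (simp add: expectation_past_mult_Z)
  finally show ?thesis .
qed

lemma mean_vec_BZ: "a < n \<Longrightarrow> (LINT w|M. (B *\<^sub>v Z w) $ a) = 0"
  using expectation_past_mult_BZ[of "\<lambda>_. 1" a] by simp

lemma bounded_BZ: "bounded_rvec M n (\<lambda>w. B *\<^sub>v Z w)"
  using B bounded_Z by (rule bounded_rvec_mult_mat)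

lemma bounded_past_AX: "bounded_rvec past n (\<lambda>w. A *\<^sub>v X w + b)"
  using bounded_rvec_mult_mat[OF A X] bounded_rvec_const[OF b] by (rule bounded_rvec_add)

lemma mean_vec_noise_step:
  "mean_vec M n (\<lambda>w. A *\<^sub>v X w + b + B *\<^sub>v Z w) = A *\<^sub>v mean_vec M l X + b"
proof -
  have AX: "bounded_rvec M n (\<lambda>w. A *\<^sub>v X w + b)"
    using bounded_past_AX by (rule bounded_rvec_subalgebra[OF subalgebra_past])
  have "mean_vec M n (\<lambda>w. A *\<^sub>v X w + b + B *\<^sub>v Z w) = mean_vec M n (\<lambda>w. A *\<^sub>v X w + b)"
  proof (intro eq_vecI)
    fix a assume "a < dim_vec (mean_vec M n (\<lambda>w. A *\<^sub>v X w + b))"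
    then have a: "a < n"
      by (simp add: mean_vec_def)
    have "(LINT w|M. (A *\<^sub>v X w + b + B *\<^sub>v Z w) $ a)
        = (LINT w|M. (A *\<^sub>v X w + b) $ a + (B *\<^sub>v Z w) $ a)"
      using a B by (intro Bochner_Integration.integral_cong) auto
    also have "\<dots> = (LINT w|M. (A *\<^sub>v X w + b) $ a) + (LINT w|M. (B *\<^sub>v Z w) $ a)"
      using AX bounded_BZ a
      by (intro Bochner_Integration.integral_add integrable_bounded_rv)
         (auto intro: bounded_rvec_entry)
    finally show "mean_vec M n (\<lambda>w. A *\<^sub>v X w + b + B *\<^sub>v Z w) $ a
        = mean_vec M n (\<lambda>w. A *\<^sub>v X w + b) $ a"
      using a by (simp add: mean_vec_index mean_vec_BZ)
  qed (simp add: mean_vec_def)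
  also have "\<dots> = A *\<^sub>v mean_vec M l X + b"
    using A b bounded_rvec_subalgebra[OF subalgebra_past X] by (rule mean_vec_affine)
  finally show ?thesis .
qed

text \<open>The noise multiplies \<open>V\<close> itself and not its centred version, so second
  moments of \<open>V\<close> appear; the part coming from the means yields the \<open>outer\<close>
  term.\<close>

lemma cov_mat_Z:
  "cov_mat M m Z = cov_mat M m Th \<odot> cov_mat M m V
     + cov_mat M m Th \<odot> outer (mean_vec M m V) (mean_vec M m V)"
proof (intro eq_matI)
  fix a c assume "a < dim_row (cov_mat M m Th \<odot> cov_mat M m V
     + cov_mat M m Th \<odot> outer (mean_vec M m V) (mean_vec M m V))"
    and "c < dim_col (cov_mat M m Th \<odot> cov_mat M m V
     + cov_mat M m Th \<odot> outer (mean_vec M m V) (mean_vec M m V))"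
  then have ac: "a < m" "c < m"
    by (auto simp: hadamard_def cov_mat_def mean_mat_def)
  let ?t = "\<lambda>a w. Th w $ a - (LINT w|M. Th w $ a)"
  have VM: "bounded_rvec M m V"
    using V by (rule bounded_rvec_subalgebra[OF subalgebra_past])
  have ThM: "bounded_rvec M m Th"
    using Th by (rule bounded_rvec_subalgebra[OF subalgebra_present])
  have Z0: "(LINT w|M. Z w $ e) = 0" if "e < m" for e
    using expectation_past_mult_Z[of "\<lambda>_. 1" e] that by simp
  \<comment> \<open>Since \<open>Z\<close> has mean zero its covariance is a second moment; the
    factors are grouped into one from the past and one from the present.\<close>
  have "cov_mat M m Z $$ (a, c) = (LINT w|M. (V w $ a * V w $ c) * (?t a w * ?t c w))"
    using ac Z
    by (subst cov_mat_index) (auto simp: Z0 Z_entry mult_ac intro!: Bochner_Integration.integral_cong)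
  also have "\<dots> = (LINT w|M. V w $ a * V w $ c) * (LINT w|M. ?t a w * ?t c w)"
    using ac V by (intro expectation_mult_past_present bounded_rv_mult noise_entry bounded_rvec_entry)
  also have "(LINT w|M. ?t a w * ?t c w) = cov_mat M m Th $$ (a, c)"
    using ac ThM by (simp add: cov_mat_index bounded_rvec_carrier)
  also have "(LINT w|M. V w $ a * V w $ c)
      = cov_mat M m V $$ (a, c) + (LINT w|M. V w $ a) * (LINT w|M. V w $ c)"
  proof -
    have "integrable M (\<lambda>w. V w $ a)" "integrable M (\<lambda>w. V w $ c)"
        "integrable M (\<lambda>w. V w $ a * V w $ c)"
      using VM ac by (auto intro!: integrable_bounded_rv bounded_rv_mult bounded_rvec_entry)
    then show ?thesis
      using ac VM
      by (simp add: cov_mat_index bounded_rvec_carrier left_diff_distrib right_diff_distrib prob_space)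
  qed
  finally show "cov_mat M m Z $$ (a, c) = (cov_mat M m Th \<odot> cov_mat M m V
     + cov_mat M m Th \<odot> outer (mean_vec M m V) (mean_vec M m V)) $$ (a, c)"
    using ac
    by (simp add: hadamard_def outer_def mean_vec_index carrier_matD[OF cov_mat_carrier]
        carrier_vecD[OF mean_vec_carrier] algebra_simps)
qed (simp_all add: hadamard_def cov_mat_def mean_mat_def)

text \<open>Each entry of \<open>A *\<^sub>v X w + b\<close> is determined by the past, hence
  uncorrelated with the noise term, and the two covariances add up.\<close>

lemma cov_mat_noise_step:
  "cov_mat M n (\<lambda>w. A *\<^sub>v X w + b + B *\<^sub>v Z w)
     = A * cov_mat M l X * transpose_mat A
       + B * (cov_mat M m Th \<odot> cov_mat M m V) * transpose_mat B
       + B * (cov_mat M m Th \<odot> outer (mean_vec M m V) (mean_vec M m V)) * transpose_mat B"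
proof -
  let ?Q = "cov_mat M m Th \<odot> cov_mat M m V"
  let ?R = "cov_mat M m Th \<odot> outer (mean_vec M m V) (mean_vec M m V)"
  have QR: "?Q \<in> carrier_mat m m" "?R \<in> carrier_mat m m"
    by (auto simp: hadamard_def cov_mat_def mean_mat_def)
  have "cov_mat M n (\<lambda>w. A *\<^sub>v X w + b + B *\<^sub>v Z w)
      = cov_mat M n (\<lambda>w. A *\<^sub>v X w + b) + cov_mat M n (\<lambda>w. B *\<^sub>v Z w)"
    using bounded_past_AX
    by (intro cov_mat_add_uncorrelated bounded_BZ mean_vec_BZ expectation_past_mult_BZ)
       (auto intro: bounded_rvec_entry bounded_rvec_subalgebra[OF subalgebra_past])
  also have "cov_mat M n (\<lambda>w. A *\<^sub>v X w + b) = A * cov_mat M l X * transpose_mat A"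
    using A b bounded_rvec_subalgebra[OF subalgebra_past X] by (rule cov_mat_affine)
  \<comment> \<open>A zero offset turns the linear image into the affine form of
    \<open>cov_mat_affine\<close>.\<close>
  also have "cov_mat M n (\<lambda>w. B *\<^sub>v Z w) = cov_mat M n (\<lambda>w. B *\<^sub>v Z w + 0\<^sub>v n)"
    using B by (intro cov_mat_cong) auto
  also have "\<dots> = B * cov_mat M m Z * transpose_mat B"
    using B bounded_Z by (intro cov_mat_affine) auto
  also have "\<dots> = B * ?Q * transpose_mat B + B * ?R * transpose_mat B"
  proof -
    have "B * (?Q + ?R) = B * ?Q + B * ?R"
      using B QR by (rule mult_add_distrib_mat)
    moreover have "(B * ?Q + B * ?R) * transpose_mat B = B * ?Q * transpose_mat B + B * ?R * transpose_mat B"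
      using B QR by (intro add_mult_distrib_mat[of _ n m]) auto
    ultimately show ?thesis
      by (simp add: cov_mat_Z)
  qed
  finally show ?thesis
    by (subst assoc_add_mat[of _ n n])
       (use A B QR in \<open>auto intro!: mult_carrier_mat[of _ n m] mult_carrier_mat[of _ n l]\<close>)
qed

end

end

end

section \<open>The channel history\<close>

context lossy_channels
begin

text \<open>
  The present is indexed by the singleton \<open>{k}\<close> so that it has the same form as the history; also,
  \<open>indep_var\<close> needs both variables to have the same type.
\<close>

definition channels :: "nat \<Rightarrow> 'w \<Rightarrow> nat \<Rightarrow> real" where
  "channels k w = (\<lambda>i\<in>{1..N}. \<theta> i k w)"

abbreviation "chspace \<equiv> Pi\<^sub>M {1..N} (\<lambda>_. borel :: real measure)"

text \<open>Time \<open>k\<close> itself is excluded. For \<open>k = 0\<close> the history is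
  constant, so \<open>past_alg 0\<close> is trivial and only deterministic states are measurable for
  it.\<close>

definition history :: "nat \<Rightarrow> 'w \<Rightarrow> nat \<Rightarrow> nat \<Rightarrow> real" where
  "history k w = (\<lambda>j\<in>{..<k}. channels j w)"

abbreviation "past_alg k \<equiv> vimage_algebra (space M) (history k) (Pi\<^sub>M {..<k} (\<lambda>_. chspace))"
abbreviation "present_alg k \<equiv>
  vimage_algebra (space M) (\<lambda>w. \<lambda>j\<in>{k}. channels j w) (Pi\<^sub>M {k} (\<lambda>_. chspace))"

lemma channels_measurable: "channels k \<in> measurable M chspace"
  using indep unfolding indep_vars_def channels_def[abs_def] by simp

text \<open>Independence over time passes to the disjoint sets of times \<open>{..<k}\<close> and
  \<open>{k}\<close>.\<close>

lemma indep_history_channels: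
  "indep_var (Pi\<^sub>M {..<k} (\<lambda>_. chspace)) (history k)
     (Pi\<^sub>M {k} (\<lambda>_. chspace)) (\<lambda>w. \<lambda>j\<in>{k}. channels j w)"
  using indep_var_restrict[OF indep, of "{..<k}" "{k}"]
  unfolding history_def[abs_def] channels_def[abs_def] by simp

lemma history_funcset: "history k \<in> space M \<rightarrow> space (Pi\<^sub>M {..<k} (\<lambda>_. chspace))"
  using indep_history_channels unfolding indep_var_eq by (auto dest: measurable_space)

text \<open>The set \<open>J\<close> is kept general to serve both the history, with
  \<open>J = {..<k}\<close>, and the present, with \<open>J = {k}\<close>. Measurability comes from
  projecting first to time \<open>j\<close> and then to channel \<open>i\<close>.\<close>

lemma theta_bounded:
  assumes i: "i \<in> {1..N}" and j: "j \<in> J"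
  shows "bounded_rv (vimage_algebra (space M) (\<lambda>w. \<lambda>j\<in>J. channels j w) (Pi\<^sub>M J (\<lambda>_. chspace))) (\<theta> i j)"
    (is "bounded_rv ?F _")
  unfolding bounded_rv_def
proof
  have "(\<lambda>w. \<lambda>j\<in>J. channels j w) \<in> measurable M (Pi\<^sub>M J (\<lambda>_. chspace))"
    by (intro measurable_restrict channels_measurable)
  then have "(\<lambda>w. \<lambda>j\<in>J. channels j w) \<in> measurable ?F (Pi\<^sub>M J (\<lambda>_. chspace))"
    by (intro measurable_vimage_algebra1) (auto dest: measurable_space)
  from measurable_compose[OF this measurable_component_singleton[OF j]]
  have "(\<lambda>w. (\<lambda>j\<in>J. channels j w) j) \<in> measurable ?F chspace" .
  from measurable_compose[OF this measurable_component_singleton[OF i]]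
  have "(\<lambda>w. (\<lambda>j\<in>J. channels j w) j i) \<in> borel_measurable ?F" .
  then show "\<theta> i j \<in> borel_measurable ?F"
    using i j by (simp add: channels_def)
  show "\<exists>c. \<forall>w\<in>space ?F. \<bar>\<theta> i j w\<bar> \<le> c"
  proof (intro exI ballI)
    fix w assume "w \<in> space ?F"
    then show "\<bar>\<theta> i j w\<bar> \<le> 1"
      using binary[OF i, of w j] by auto
  qed
qed

text \<open>Truncating the longer history is measurable and recovers the shorter one.\<close>

lemma past_alg_mono: "subalgebra (past_alg (Suc k)) (past_alg k)"
proof -
  have "(\<lambda>h. restrict h {..<k}) \<in> measurable (Pi\<^sub>M {..<Suc k} (\<lambda>_. chspace)) (Pi\<^sub>M {..<k} (\<lambda>_. chspace))"
    by (intro measurable_restrict_subset) auto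
  moreover have "history (Suc k) \<in> measurable (past_alg (Suc k)) (Pi\<^sub>M {..<Suc k} (\<lambda>_. chspace))"
    by (intro measurable_vimage_algebra1 history_funcset)
  ultimately have "(\<lambda>w. restrict (history (Suc k) w) {..<k})
      \<in> measurable (past_alg (Suc k)) (Pi\<^sub>M {..<k} (\<lambda>_. chspace))"
    by (rule measurable_compose[rotated])
  moreover have "restrict (history (Suc k) w) {..<k} = history k w" for w
    by (auto simp: history_def restrict_def)
  ultimately have "history k \<in> measurable (past_alg (Suc k)) (Pi\<^sub>M {..<k} (\<lambda>_. chspace))"
    by simp
  then show ?thesis
    by (simp add: subalgebra_def sets_image_in_sets)
qed

text \<open>The expectation depends only on the law of the channel vector, which
  \<open>ident\<close> makes the same at all times.\<close>

lemma expectation_channels_stationary: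
  assumes "g \<in> borel_measurable chspace"
  shows "(LINT w|M. g (channels k w)) = (LINT w|M. (g (channels l w) :: real))"
proof -
  have "(LINT w|M. g (channels j w)) = integral\<^sup>L (distr M chspace (channels j)) g" for j
    using assms channels_measurable by (simp add: integral_distr)
  then show ?thesis
    using ident[of k l] by (simp add: channels_def[abs_def])
qed

end

section \<open>The platoon\<close>

lemma platoon_matrices_carrier:
  "blA P \<in> carrier_mat (dimX P) (dimX P)" "blB P \<in> carrier_mat (dimX P) 1"
  "calB P \<in> carrier_mat (dimX P) (dimV P)"
  "blC\<zeta> P \<in> carrier_mat (nfol P) (dimX P)" "blD\<zeta> P \<in> carrier_mat (nfol P) 1"
  "blCv P \<in> carrier_mat (dimV P) (dimX P)" "blDv P \<in> carrier_mat (dimV P) 1"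
  by (simp_all add: blA_def blB_def calB_def blC\<zeta>_def blD\<zeta>_def blCv_def blDv_def block_bidiag_def
      block_diag_def first_block_col_def block_mat_def dimX_def dimV_def)

lemma scal_carrier: "scal r \<in> carrier_vec 1"
  by (simp add: scal_def)

text \<open>A diagonal matrix acts entrywise, which gives the noise-times-signal form that the noise
  step requires.\<close>

lemma v_breve_entry:
  assumes "a < dimV P"
  shows "v_breve P \<theta> v k w $ a = (\<Theta>vec P \<theta> k w $ a - repeat_nv P (prb P) $ a) * stackV P v k w $ a"
proof -
  let ?t = "\<Theta>vec P \<theta> k w $ a - repeat_nv P (prb P) $ a"
  have car: "\<Theta>d_bar P \<theta> k w \<in> carrier_mat (dimV P) (dimV P)"
    by (simp add: \<Theta>d_bar_def \<Theta>d_def \<Upsilon>_def mat_diag_def minus_carrier_mat)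
  have V: "stackV P v k w \<in> carrier_vec (dimV P)"
    by (simp add: stackV_def block_vec_def dimV_def carrier_vecI)
  have diag: "\<Theta>d_bar P \<theta> k w $$ (a, c) = (if a = c then ?t else 0)" if "c < dimV P" for c
    using assms that by (simp add: \<Theta>d_bar_def \<Theta>d_def \<Upsilon>_def mat_diag_def)
  have "v_breve P \<theta> v k w $ a = (\<Sum>c<dimV P. \<Theta>d_bar P \<theta> k w $$ (a, c) * stackV P v k w $ c)"
    unfolding v_breve_def using car V assms by (rule mult_mat_vec_entry)
  also have "\<dots> = (\<Sum>c<dimV P. if a = c then ?t * stackV P v k w $ a else 0)"
    by (intro sum.cong refl) (simp add: diag)
  also have "\<dots> = ?t * stackV P v k w $ a"
    using assms by simp
  finally show ?thesis .
qed

theorem lemma2: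
  fixes M :: "'w measure" and P :: platoon
    and \<theta> :: "nat \<Rightarrow> nat \<Rightarrow> 'w \<Rightarrow> real"
    and y\<^sub>0 :: "nat \<Rightarrow> real"
    and x :: "nat \<Rightarrow> nat \<Rightarrow> 'w \<Rightarrow> real vec"
    and \<zeta> :: "nat \<Rightarrow> nat \<Rightarrow> 'w \<Rightarrow> real"
    and v :: "nat \<Rightarrow> nat \<Rightarrow> 'w \<Rightarrow> real vec"
  assumes "platoon_wf P"
    and "lossy_channels M (nfol P) (prb P) \<theta>"
    and "\<And>i k w. i \<in> {1..nfol P} \<Longrightarrow> w \<in> space M \<Longrightarrow> x i k w \<in> carrier_vec (nx P i)"
    and "\<And>i k w. i \<in> {1..nfol P} \<Longrightarrow> w \<in> space M \<Longrightarrow> v i k w \<in> carrier_vec (nv P)"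
    and "\<And>i w. i \<in> {1..nfol P} \<Longrightarrow> w \<in> space M \<Longrightarrow> x i 0 w = x0 P i"
    and "\<And>k w. w \<in> space M \<Longrightarrow>
          stackX P x (k + 1) w =
            blA P *\<^sub>v stackX P x k w + blB P *\<^sub>v scal (y\<^sub>0 k) + calB P *\<^sub>v v_breve P \<theta> v k w"
    and "\<And>k w. w \<in> space M \<Longrightarrow>
          stack\<zeta> P \<zeta> k w = blC\<zeta> P *\<^sub>v stackX P x k w + blD\<zeta> P *\<^sub>v scal (y\<^sub>0 k)"
    and "\<And>k w. w \<in> space M \<Longrightarrow>
          stackV P v k w = blCv P *\<^sub>v stackX P x k w + blDv P *\<^sub>v scal (y\<^sub>0 k)"
  shows
    "let \<mu>\<^sub>x = (\<lambda>k. mean_vec M (dimX P) (stackX P x k));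
         \<mu>\<^sub>\<zeta> = (\<lambda>k. mean_vec M (nfol P) (stack\<zeta> P \<zeta> k));
         \<mu>\<^sub>v = (\<lambda>k. mean_vec M (dimV P) (stackV P v k));
         P\<^sub>x = (\<lambda>k. cov_mat M (dimX P) (stackX P x k));
         P\<^sub>\<zeta> = (\<lambda>k. cov_mat M (nfol P) (stack\<zeta> P \<zeta> k));
         P\<^sub>v = (\<lambda>k. cov_mat M (dimV P) (stackV P v k))
     in \<forall>k.
       \<mu>\<^sub>x (k + 1) = blA P *\<^sub>v \<mu>\<^sub>x k + blB P *\<^sub>v scal (y\<^sub>0 k) \<and>
       \<mu>\<^sub>\<zeta> k = blC\<zeta> P *\<^sub>v \<mu>\<^sub>x k + blD\<zeta> P *\<^sub>v scal (y\<^sub>0 k) \<and>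
       \<mu>\<^sub>v k = blCv P *\<^sub>v \<mu>\<^sub>x k + blDv P *\<^sub>v scal (y\<^sub>0 k) \<and>
       P\<^sub>x (k + 1) =
         blA P * P\<^sub>x k * transpose_mat (blA P)
         + calB P * (P\<Theta> M P \<theta> \<odot> P\<^sub>v k) * transpose_mat (calB P)
         + calB P * (P\<Theta> M P \<theta> \<odot> outer (\<mu>\<^sub>v k) (\<mu>\<^sub>v k)) * transpose_mat (calB P) \<and>
       P\<^sub>\<zeta> k = blC\<zeta> P * P\<^sub>x k * transpose_mat (blC\<zeta> P) \<and>
       P\<^sub>v k = blCv P * P\<^sub>x k * transpose_mat (blCv P)"
proof -
  interpret lossy_channels M "nfol P" "prb P" \<theta>
    by (rule assms(2))
  note car = platoon_matrices_carrier[of P]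
  let ?X = "stackX P x" and ?V = "stackV P v"
  have drive: "F *\<^sub>v scal r \<in> carrier_vec n" if "F \<in> carrier_mat n 1" for F n r
    using that scal_carrier by (rule mult_mat_vec_carrier)
  \<comment> \<open>The algebra \<open>F\<close> is left open: the induction below needs
    \<open>past_alg (Suc k)\<close>, the noise step \<open>past_alg k\<close>.\<close>
  have V_past: "bounded_rvec F (dimV P) (?V k)"
    if "space F = space M" "bounded_rvec F (dimX P) (?X k)" for F k
  proof -
    have "bounded_rvec F (dimV P) (\<lambda>w. blCv P *\<^sub>v ?X k w + blDv P *\<^sub>v scal (y\<^sub>0 k))"
      by (rule bounded_rvec_add[OF bounded_rvec_mult_mat[OF car(6) that(2)]
            bounded_rvec_const[OF drive[OF car(7)]]])
    then show ?thesis
      using that(1) assms(8) by (subst bounded_rvec_cong) auto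
  qed
  have \<Theta>_entry: "\<Theta>vec P \<theta> k w $ a = \<theta> (block_of (\<lambda>_. nv P) a) k w" if "a < dimV P" for a k w
    using repeat_nv_index[OF that] by (simp add: \<Theta>vec_def)
  have \<Theta>_carrier: "\<Theta>vec P \<theta> k w \<in> carrier_vec (dimV P)" for k w
    by (simp add: \<Theta>vec_def repeat_nv_def block_vec_def dimV_def carrier_vecI)
  have \<Theta>_bounded: "bounded_rvec
      (vimage_algebra (space M) (\<lambda>w. \<lambda>j\<in>J. channels j w) (Pi\<^sub>M J (\<lambda>_. chspace))) (dimV P) (\<Theta>vec P \<theta> k)"
    if "k \<in> J" for J k
    unfolding bounded_rvec_def
  proof (intro conjI ballI allI impI \<Theta>_carrier)
    fix a assume a: "a < dimV P"
    show "bounded_rv (vimage_algebra (space M) (\<lambda>w. \<lambda>j\<in>J. channels j w) (Pi\<^sub>M J (\<lambda>_. chspace)))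
        (\<lambda>w. \<Theta>vec P \<theta> k w $ a)"
      unfolding \<Theta>_entry[OF a] using repeat_nv_index(2)[OF a] that by (rule theta_bounded)
  qed
  \<comment> \<open>This identifies the centring by \<open>prb\<close> in \<open>v_breve\<close>
    with centring by the expectation, as the noise step demands.\<close>
  have \<Theta>_mean: "(LINT w|M. \<Theta>vec P \<theta> k w $ a) = repeat_nv P (prb P) $ a" if "a < dimV P" for a k
    using mean[OF repeat_nv_index(2)[OF that]]
    by (simp only: \<Theta>_entry[OF that] repeat_nv_index(1)[OF that])
  have Z_carrier: "v_breve P \<theta> v k w \<in> carrier_vec (dimV P)" for k w
    by (simp add: v_breve_def \<Theta>d_bar_def \<Upsilon>_def mat_diag_def carrier_vecI)
  \<comment> \<open>The state at time \<open>k + 1\<close> involves the outcomes at time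
    \<open>k\<close>, the last ones recorded in \<open>history (Suc k)\<close>; this matches the
    strict bound in \<open>history\<close>.\<close>
  have X_past: "bounded_rvec (past_alg k) (dimX P) (?X k)" for k
  proof (induction k)
    case 0
    \<comment> \<open>The initial state is deterministic, hence constant on the space and measurable
      even for the trivial algebra.\<close>
    have "?X 0 w = block_vec (nfol P) (nx P) (x0 P)" if "w \<in> space M" for w
      using that assms(5) block_of_bounds(1)
      unfolding stackX_def block_vec_def by (intro eq_vecI) auto
    moreover have "block_vec (nfol P) (nx P) (x0 P) \<in> carrier_vec (dimX P)"
      by (simp add: block_vec_def dimX_def)
    ultimately show ?case
      by (subst bounded_rvec_cong) (auto intro: bounded_rvec_const)
  next
    case (Suc k)
    let ?F = "past_alg (Suc k)"
    have X: "bounded_rvec ?F (dimX P) (?X k)"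
      using past_alg_mono Suc.IH by (rule bounded_rvec_subalgebra)
    have V: "bounded_rvec ?F (dimV P) (?V k)"
      using X by (intro V_past) simp_all
    have \<Theta>: "bounded_rvec ?F (dimV P) (\<Theta>vec P \<theta> k)"
      using \<Theta>_bounded[of k "{..<Suc k}"] by (simp add: history_def[abs_def])
    have Z: "bounded_rvec ?F (dimV P) (v_breve P \<theta> v k)"
      unfolding bounded_rvec_def
    proof (intro conjI ballI allI impI Z_carrier)
      fix a assume a: "a < dimV P"
      show "bounded_rv ?F (\<lambda>w. v_breve P \<theta> v k w $ a)"
        unfolding v_breve_entry[OF a]
        by (rule bounded_rv_mult[OF bounded_rv_diff[OF bounded_rvec_entry[OF \<Theta> a] bounded_rv_const]
              bounded_rvec_entry[OF V a]])
    qed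
    have "bounded_rvec ?F (dimX P)
        (\<lambda>w. blA P *\<^sub>v ?X k w + blB P *\<^sub>v scal (y\<^sub>0 k) + calB P *\<^sub>v v_breve P \<theta> v k w)"
      by (rule bounded_rvec_add[OF bounded_rvec_add[OF bounded_rvec_mult_mat[OF car(1) X]
            bounded_rvec_const[OF drive[OF car(2)]]] bounded_rvec_mult_mat[OF car(3) Z]])
    then show ?case
      using assms(6)[of _ k] by (subst bounded_rvec_cong) auto
  qed
  have X_bounded: "bounded_rvec M (dimX P) (?X k)" for k
    using subalgebra_past[OF indep_history_channels] X_past by (rule bounded_rvec_subalgebra)
  \<comment> \<open>\<open>P\<Theta>\<close> is defined at time 0, whereas the noise step produces
    the covariance at time \<open>k\<close>.\<close>
  have cov_\<Theta>: "cov_mat M (dimV P) (\<Theta>vec P \<theta> k) = P\<Theta> M P \<theta>" for k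
    unfolding P\<Theta>_def
  proof (intro eq_matI)
    fix a b assume "a < dim_row (cov_mat M (dimV P) (\<Theta>vec P \<theta> 0))"
      and "b < dim_col (cov_mat M (dimV P) (\<Theta>vec P \<theta> 0))"
    then have ab: "a < dimV P" "b < dimV P"
      by (simp_all add: carrier_matD[OF cov_mat_carrier])
    let ?i = "block_of (\<lambda>_. nv P) a" and ?j = "block_of (\<lambda>_. nv P) b"
    have ij: "?i \<in> {1..nfol P}" "?j \<in> {1..nfol P}"
      using ab by (simp_all only: repeat_nv_index(2))
    \<comment> \<open>With the means replaced by the constants \<open>prb\<close>, the covariance
      entry at any time is the expectation of one fixed function of the channel vector at that
      time.\<close>
    define g where "g h = (h ?i - prb P ?i) * (h ?j - prb P ?j)" for h :: "nat \<Rightarrow> real"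
    have "g \<in> borel_measurable chspace"
      unfolding g_def[abs_def] using ij by measurable
    moreover have "cov_mat M (dimV P) (\<Theta>vec P \<theta> l) $$ (a, b) = (LINT w|M. g (channels l w))" for l
      using ab ij mean[OF ij(1)] mean[OF ij(2)]
      by (simp add: cov_mat_index \<Theta>_carrier \<Theta>_entry g_def channels_def)
    ultimately show "cov_mat M (dimV P) (\<Theta>vec P \<theta> k) $$ (a, b)
        = cov_mat M (dimV P) (\<Theta>vec P \<theta> 0) $$ (a, b)"
      using expectation_channels_stationary[of g k 0] by simp
  qed (simp_all add: carrier_matD[OF cov_mat_carrier])
  have step:
    "mean_vec M (dimX P) (?X (k + 1))
      = blA P *\<^sub>v mean_vec M (dimX P) (?X k) + blB P *\<^sub>v scal (y\<^sub>0 k)" (is ?mean)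
    "cov_mat M (dimX P) (?X (k + 1))
      = blA P * cov_mat M (dimX P) (?X k) * transpose_mat (blA P)
        + calB P * (P\<Theta> M P \<theta> \<odot> cov_mat M (dimV P) (?V k)) * transpose_mat (calB P)
        + calB P * (P\<Theta> M P \<theta> \<odot> outer (mean_vec M (dimV P) (?V k)) (mean_vec M (dimV P) (?V k)))
          * transpose_mat (calB P)" (is ?cov) for k
  proof -
    have V: "bounded_rvec (past_alg k) (dimV P) (?V k)"
      using X_past by (intro V_past) simp_all
    have Z: "v_breve P \<theta> v k w $ a
        = (\<Theta>vec P \<theta> k w $ a - (LINT w|M. \<Theta>vec P \<theta> k w $ a)) * ?V k w $ a" if "a < dimV P" for w a
      using that by (simp add: v_breve_entry \<Theta>_mean)
    have \<Theta>: "bounded_rvec (present_alg k) (dimV P) (\<Theta>vec P \<theta> k)"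
      by (rule \<Theta>_bounded) simp
    \<comment> \<open>These facts discharge, in order, the assumptions of the noise contexts, with
      \<open>\<Theta>vec\<close> as \<open>Th\<close> and \<open>v_breve\<close> as
      \<open>Z\<close>.\<close>
    note noise = indep_history_channels[of k] car(1,3) drive[OF car(2), of "y\<^sub>0 k"]
      X_past[of k] V \<Theta> Z_carrier[of k] Z
    show ?mean
      using mean_vec_noise_step[OF noise] by (subst mean_vec_cong[OF assms(6)])
    show ?cov
      using cov_mat_noise_step[OF noise] unfolding cov_\<Theta> by (subst cov_mat_cong[OF assms(6)])
  qed
  \<comment> \<open>Tracking error and channel input are both noise-free affine images of the
    current state, so one statement covers the two.\<close>
  have out:
    "mean_vec M n Y = C *\<^sub>v mean_vec M (dimX P) (?X k) + D *\<^sub>v scal (y\<^sub>0 k)"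
    "cov_mat M n Y = C * cov_mat M (dimX P) (?X k) * transpose_mat C"
    if "\<And>w. w \<in> space M \<Longrightarrow> Y w = C *\<^sub>v ?X k w + D *\<^sub>v scal (y\<^sub>0 k)"
      "C \<in> carrier_mat n (dimX P)" "D \<in> carrier_mat n 1" for Y C D n k
    by (rule trans[OF mean_vec_cong[where X = Y, OF that(1)]
            mean_vec_affine[OF that(2) drive[OF that(3)] X_bounded]], assumption)
       (rule trans[OF cov_mat_cong[where X = Y, OF that(1)]
            cov_mat_affine[OF that(2) drive[OF that(3)] X_bounded]], assumption)
  note \<zeta>_out = out[of "stack\<zeta> P \<zeta> k" "blC\<zeta> P" k "blD\<zeta> P" "nfol P" for k, OF assms(7) car(4,5)]
  note v_out = out[of "?V k" "blCv P" k "blDv P" "dimV P" for k, OF assms(8) car(6,7)]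
  show ?thesis
    unfolding Let_def
    by (intro allI conjI; (rule step \<zeta>_out v_out; assumption))
qed

end
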